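(* Let $Q:\mathbb{R}\to\mathbb{R}$ be continuous and $1$-periodic, let $\Delta:\mathbb{C}\to\mathbb{C}$ be the discriminant of the Hill equation $-u''+Qu=\lambda u$, and let $s(\cdot;z)$ be the solution of $-u''+Qu=zu$ with $s(0;z)=0$ and $s'(0;z)=1$. Then the two functions $$h_+(z):=-\frac{\Delta(z)+2}{s(1;z)},\qquad h_-(z):=-\frac{\Delta(z)-2}{s(1;z)},\qquad z\in\mathbb{C}\setminus\mathbb{R},$$ are non-constant Herglotz functions.
   Context: For $\lambda\in\mathbb{C}$, $s(\cdot;\lambda)$ and $c(\cdot;\lambda)$ denote the solutions of $-u''+Qu=\lambda u$ with $s(0;\lambda)=c'(0;\lambda)=0$ and $s'(0;\lambda)=c(0;\lambda)=1$, where the prime is the derivative with respect to the spatial variable $x$. The discriminant is $\Delta(\lambda):=s'(1;\lambda)+c(1;\lambda)$. The zeros of $z\mapsto s(1;z)$ are the Dirichlet eigenvalues of $u\mapsto -u''+Qu$ on $(0,1)$, which are real. A Herglotz function is a holomorphic map $h:\mathbb{C}\setminus\mathbb{R}\to\mathbb{C}$ such that $h(\overline z)=\overline{h(z)}$ and $\operatorname{Im} z\cdot\operatorname{Im} h(z)\ge 0$ for all $z\in\mathbb{C}\setminus\mathbb{R}$. *)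

theory Defs
  imports "HOL-Complex_Analysis.Complex_Analysis"
begin

definition dx :: "(real \<Rightarrow> complex) \<Rightarrow> real \<Rightarrow> complex" where
  "dx u x = vector_derivative u (at x)"

(* The differentiability clauses are needed because vector_derivative is
   unspecified where the derivative does not exist. *)
definition hill_solution :: "(real \<Rightarrow> real) \<Rightarrow> complex \<Rightarrow> (real \<Rightarrow> complex) \<Rightarrow> bool" where
  "hill_solution Q z u \<longleftrightarrow>
     (\<forall>x. u differentiable (at x)) \<and>
     (\<forall>x. dx u differentiable (at x)) \<and>
     (\<forall>x. - dx (dx u) x + complex_of_real (Q x) * u x = z * u x)"

(* For continuous Q the two initial value problems below are uniquely solvable
   on the whole real line, so the definite descriptions denote. *)
definition hill_s :: "(real \<Rightarrow> real) \<Rightarrow> complex \<Rightarrow> real \<Rightarrow> complex" where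
  "hill_s Q z = (THE u. hill_solution Q z u \<and> u 0 = 0 \<and> dx u 0 = 1)"

definition hill_c :: "(real \<Rightarrow> real) \<Rightarrow> complex \<Rightarrow> real \<Rightarrow> complex" where
  "hill_c Q z = (THE u. hill_solution Q z u \<and> u 0 = 1 \<and> dx u 0 = 0)"

definition discriminant :: "(real \<Rightarrow> real) \<Rightarrow> complex \<Rightarrow> complex" where
  "discriminant Q z = dx (hill_s Q z) 1 + hill_c Q z 1"

(* The domain is the complement of the real axis; values of h on the real
   axis are irrelevant. *)
definition herglotz :: "(complex \<Rightarrow> complex) \<Rightarrow> bool" where
  "herglotz h \<longleftrightarrow>
     h holomorphic_on (UNIV - \<real>) \<and>
     (\<forall>z \<in> UNIV - \<real>. h (cnj z) = cnj (h z) \<and> Im z * Im (h z) \<ge> 0)"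

end

(* Let u solve -u'' + Qu = zu with u(0) = 1 and u(1) = b, where b = 1 or b = -1. Since the
   Wronskian of c and s is 1, the boundary term u'(1) cnj(u(1)) - u'(0) cnj(u(0)) equals
   (Delta(z) - 2b) / s(1;z), and Green's identity says that its imaginary part is
   -Im z times the integral of |u|^2 over (0,1). So h(z) = -(Delta(z) - 2b) / s(1;z) satisfies
   Im h(z) = Im z * I with I > 0, which also rules out that h is constant. Green's identity for
   s itself shows s(1;z) ~= 0 off the real axis. Differentiability in z follows from variation
   of constants: the difference of two solutions with spectral parameters w and z and the same
   initial data is w - z times an integral that depends continuously on w. *)
theory Submission
  imports Defs
begin

section \<open>Linear ordinary differential equations on the real line\<close>

text \<open>Having the two-sided derivative at negative points too lets the Picard iteration run on
  the whole line without oriented integrals.\<close>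

lemma antiderivative_on_line:
  fixes f :: "real \<Rightarrow> 'a::euclidean_space"
  assumes "continuous_on UNIV f"
  shows "\<exists>F. F 0 = 0 \<and> (\<forall>x. (F has_vector_derivative f x) (at x))"
proof -
  obtain G where G: "\<And>x. (G has_vector_derivative f x) (at x)"
    using einterval_antiderivative[of "-\<infinity>" "\<infinity>" f] assms
    by (auto simp: continuous_on_eq_continuous_at)
  have "((\<lambda>x. G x - G 0) has_vector_derivative f x) (at x)" for x
    using has_vector_derivative_diff[OF G has_vector_derivative_const[of "G 0"]] by simp
  then show ?thesis
    by (intro exI[of _ "\<lambda>x. G x - G 0"]) auto
qed

section \<open>Bounds for the Picard iteration\<close>

lemma continuous_on_interval_bounded:
  fixes f :: "real \<Rightarrow> 'a::real_normed_vector"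
  assumes "continuous_on {a..b} f"
  obtains B where "0 \<le> B" "\<And>x. a \<le> x \<Longrightarrow> x \<le> b \<Longrightarrow> norm (f x) \<le> B"
proof -
  obtain B where "\<forall>y\<in>f ` {a..b}. norm y \<le> B"
    using compact_imp_bounded[OF compact_continuous_image[OF assms compact_Icc]] bounded_iff by metis
  then have "norm (f x) \<le> \<bar>B\<bar>" if "a \<le> x" "x \<le> b" for x
    using that by (auto intro: order.trans[OF _ abs_ge_self])
  then show ?thesis by (intro that[of "\<bar>B\<bar>"]) auto
qed

lemma has_vector_derivative_reflect:
  assumes "(f has_vector_derivative f') (at (- x))"
  shows "((\<lambda>x. f (- x)) has_vector_derivative - f') (at x)"
proof -
  have "(uminus has_vector_derivative - 1) (at x)"
    unfolding has_real_derivative_iff_has_vector_derivative[symmetric]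
    by (auto intro!: derivative_eq_intros)
  from vector_diff_chain_at[OF this, of f f'] assms show ?thesis by (simp add: o_def)
qed

text \<open>One step of the Picard estimate: integrating the bound \<open>C * t ^ n\<close> from 0
  produces the factor \<open>1 / Suc n\<close>, and iterating this builds up the factorial. Negative
  points are reduced to positive ones by reflection.\<close>

lemma norm_antiderivative_power_bound:
  fixes F f :: "real \<Rightarrow> 'a::real_normed_vector"
  assumes F: "\<And>x. (F has_vector_derivative f x) (at x)" and "F 0 = 0"
    and f: "\<And>x. \<bar>x\<bar> \<le> R \<Longrightarrow> norm (f x) \<le> C * \<bar>x\<bar> ^ n"
    and x: "\<bar>x\<bar> \<le> R"
  shows "norm (F x) \<le> C / Suc n * \<bar>x\<bar> ^ Suc n"
proof -
  \<comment> \<open>Stated for arbitrary \<open>G\<close> and \<open>g\<close> so that it applies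
    both to \<open>F\<close> and to its reflection.\<close>
  have half: "norm (G y) \<le> C / Suc n * y ^ Suc n"
    if "0 \<le> y" "y \<le> R" and G: "\<And>x. (G has_vector_derivative g x) (at x)" "G 0 = 0"
      and g: "\<And>x. \<bar>x\<bar> \<le> R \<Longrightarrow> norm (g x) \<le> C * \<bar>x\<bar> ^ n"
    for G g :: "real \<Rightarrow> 'a" and y
  proof (cases "y = 0")
    case False
    have "norm (G y - G 0) \<le> C / Suc n * y ^ Suc n - C / Suc n * 0 ^ Suc n"
    proof (rule differentiable_bound_general)
      show "0 < y" using False that by simp
      show "continuous_on {0..y} G"
        using G(1) by (meson continuous_at_imp_continuous_on has_vector_derivative_continuous)
      show "continuous_on {0..y} (\<lambda>x. C / Suc n * x ^ Suc n)"
        by (intro continuous_intros)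
      show "((\<lambda>x. C / Suc n * x ^ Suc n) has_vector_derivative C * t ^ n) (at t)" for t
        using DERIV_cmult[OF DERIV_pow[of "Suc n" t UNIV], of "C / Suc n"]
        unfolding has_real_derivative_iff_has_vector_derivative[symmetric]
        by (simp del: of_nat_Suc power_Suc)
      show "norm (g t) \<le> C * t ^ n" if "0 < t" "t < y" for t
        using g[of t] that \<open>y \<le> R\<close> by simp
    qed (rule G(1))
    then show ?thesis using G by simp
  qed (use that in simp)
  show ?thesis
  proof (cases "x \<ge> 0")
    case True
    then show ?thesis using half[of x F f] assms by simp
  next
    case False
    have "((\<lambda>x. F (- x)) has_vector_derivative - f (- x)) (at x)" for x
      by (rule has_vector_derivative_reflect[OF F])
    moreover have "norm (- f (- y)) \<le> C * \<bar>y\<bar> ^ n" if "\<bar>y\<bar> \<le> R" for y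
      using f[of "- y"] that by simp
    ultimately show ?thesis
      using half[of "-x" "\<lambda>x. F (- x)" "\<lambda>x. - f (- x)"] \<open>F 0 = 0\<close> x False by simp
  qed
qed

text \<open>Picard iteration written as a series: \<open>V n\<close> is the n-fold iterated integral
  of \<open>A\<close> applied to \<open>u0\<close>, and the solution is the sum of all
  \<open>V n\<close>. On a bounded interval the terms are dominated by an exponential series, so the
  series may be differentiated term by term.\<close>

theorem linear_ode_solution_exists:
  fixes A :: "real \<Rightarrow> 'a::euclidean_space \<Rightarrow>\<^sub>L 'a"
  assumes A: "continuous_on UNIV A"
  obtains U where "U 0 = u0" "\<And>x. (U has_vector_derivative A x (U x)) (at x)"
proof -
  \<comment> \<open>Choice turns antiderivatives vanishing at 0 into an operator, as the recursion
    for \<open>V\<close> requires.\<close>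
  obtain I where I0: "\<And>f :: real \<Rightarrow> 'a. continuous_on UNIV f \<Longrightarrow> I f 0 = 0"
    and I: "\<And>f :: real \<Rightarrow> 'a. \<And>x. continuous_on UNIV f \<Longrightarrow> (I f has_vector_derivative f x) (at x)"
    using antiderivative_on_line by metis
  define V where "V = rec_nat (\<lambda>_. u0) (\<lambda>_ f. I (\<lambda>x. A x (f x)))"
  have V0: "V 0 = (\<lambda>_. u0)" and VS: "V (Suc n) = I (\<lambda>x. A x (V n x))" for n
    by (simp_all add: V_def)
  have AC: "continuous_on UNIV (\<lambda>x. A x (f x))" if "continuous_on UNIV f" for f
    using A that by (intro continuous_intros)
  have VC: "continuous_on UNIV (V n)" for n
  proof (induction n)
    case (Suc n)
    show ?case unfolding VS
      using has_vector_derivative_continuous[OF I[OF AC[OF Suc.IH]]]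
      by (intro continuous_at_imp_continuous_on) blast
  qed (simp add: V0)
  have VD: "(V (Suc n) has_vector_derivative A x (V n x)) (at x)" for n x
    unfolding VS by (rule I[OF AC[OF VC]])
  have VS0: "V (Suc n) 0 = 0" for n
    unfolding VS by (rule I0[OF AC[OF VC]])
  define U where "U x = (\<Sum>n. V n x)" for x
  \<comment> \<open>A bound on \<open>A\<close> is available only on bounded intervals, so the
    argument runs on (-R, R) for each \<open>R\<close>; the function \<open>U\<close> does not
    depend on \<open>R\<close>.\<close>
  have local: "(\<lambda>n. V n x) sums U x \<and> (U has_vector_derivative A x (U x)) (at x)"
    if x: "x \<in> {-R<..<R}" for x R
  proof -
    obtain K where K: "\<And>x. \<bar>x\<bar> \<le> R \<Longrightarrow> norm (A x) \<le> K"
    proof (rule continuous_on_interval_bounded[OF continuous_on_subset[OF A subset_UNIV], of "-R" R])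
      fix K assume K: "\<And>x. - R \<le> x \<Longrightarrow> x \<le> R \<Longrightarrow> norm (A x) \<le> K"
      show ?thesis by (rule that[OF K]) auto
    qed
    have "K \<ge> 0" using K[of 0] x norm_ge_zero[of "A 0"] by (auto simp del: norm_ge_zero)
    have bound: "norm (V n y) \<le> norm u0 * K ^ n / fact n * \<bar>y\<bar> ^ n" if "\<bar>y\<bar> \<le> R" for n y
      using that
    proof (induction n arbitrary: y)
      case (Suc n)
      have "norm (A t (V n t)) \<le> (K * (norm u0 * K ^ n / fact n)) * \<bar>t\<bar> ^ n" if "\<bar>t\<bar> \<le> R" for t
      proof -
        have "norm (A t (V n t)) \<le> norm (A t) * norm (V n t)" by (rule norm_blinfun)
        also have "\<dots> \<le> K * (norm u0 * K ^ n / fact n * \<bar>t\<bar> ^ n)"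
          using Suc.IH[OF that] K[OF that] \<open>K \<ge> 0\<close> by (intro mult_mono) auto
        finally show ?thesis by (simp add: mult.assoc)
      qed
      from norm_antiderivative_power_bound[OF VD VS0 this Suc.prems]
      show ?case by (simp add: field_simps)
    qed (simp add: V0)
    \<comment> \<open>The terms of \<open>norm u0\<close> times the exponential series at
      \<open>K * R\<close>: a majorant independent of \<open>y\<close> for the Weierstrass
      test.\<close>
    define M where "M n = norm u0 * ((K * R) ^ n /\<^sub>R fact n)" for n
    have VM: "norm (V n y) \<le> M n" if "\<bar>y\<bar> \<le> R" for n y
    proof -
      have "norm u0 * K ^ n / fact n * \<bar>y\<bar> ^ n \<le> norm u0 * K ^ n / fact n * R ^ n"
        using that \<open>K \<ge> 0\<close> by (intro mult_left_mono power_mono) auto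
      with bound[OF that, of n] show ?thesis
        by (simp add: M_def power_mult_distrib field_simps)
    qed
    have "summable M"
      unfolding M_def by (intro summable_mult summable_exp_generic)
    have unif: "uniform_limit {-R<..<R} (\<lambda>n x. \<Sum>i<n. V i x) U sequentially"
      unfolding U_def by (rule Weierstrass_m_test[OF VM \<open>summable M\<close>]) auto
    have sums: "(\<lambda>n. V n y) sums U y" if "y \<in> {-R<..<R}" for y
      using tendsto_uniform_limitI[OF unif that] by (simp add: sums_def)
    \<comment> \<open>The derivative of \<open>V n\<close>. It is \<open>A\<close> applied to the
      preceding term, so the first \<open>Suc m\<close> derivatives add up to \<open>A\<close>
      applied to the first \<open>m\<close> terms.\<close>
    define f' where "f' n x = (case n of 0 \<Rightarrow> 0 | Suc m \<Rightarrow> A x (V m x))" for n x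
    have f'_sum: "(\<Sum>i<Suc m. f' i x) = A x (\<Sum>i<m. V i x)" for m x
      unfolding sum.lessThan_Suc_shift f'_def by (simp add: blinfun.sum_right)
    have "\<exists>g. \<forall>x\<in>{-R<..<R}. (\<lambda>n. V n x) sums g x \<and>
          (g has_derivative (\<lambda>h. h *\<^sub>R A x (U x))) (at x within {-R<..<R})"
    proof (rule has_derivative_series)
      fix n y
      have "(V n has_vector_derivative f' n y) (at y)"
        by (cases n) (auto simp: f'_def V0 VD)
      then show "(V n has_derivative (\<lambda>h. h *\<^sub>R f' n y)) (at y within {-R<..<R})"
        unfolding has_vector_derivative_def by (rule has_derivative_at_withinI)
    next
      fix e :: real assume "e > 0"
      \<comment> \<open>Dividing by \<open>K + 1\<close> instead of \<open>K\<close> covers the case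
        \<open>K = 0\<close>.\<close>
      then have "e / (K + 1) > 0" using \<open>K \<ge> 0\<close> by simp
      from uniform_limitD[OF unif this]
      obtain N where N: "\<And>n y. n \<ge> N \<Longrightarrow> y \<in> {-R<..<R} \<Longrightarrow>
          dist (\<Sum>i<n. V i y) (U y) < e / (K + 1)"
        unfolding eventually_sequentially by blast
      have "norm ((\<Sum>i<n. h *\<^sub>R f' i y) - h *\<^sub>R A y (U y)) \<le> e * norm h"
        if n: "n \<ge> Suc N" and y: "y \<in> {-R<..<R}" for n y and h :: real
      proof -
        obtain m where m: "n = Suc m" "m \<ge> N" using n by (cases n) auto
        have "norm (A y) \<le> K" using K[of y] y by auto
        have "norm (A y ((\<Sum>i<m. V i y) - U y)) \<le> norm (A y) * norm ((\<Sum>i<m. V i y) - U y)"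
          by (rule norm_blinfun)
        also have "\<dots> \<le> (K + 1) * (e / (K + 1))"
          using N[OF m(2) y] \<open>norm (A y) \<le> K\<close> \<open>K \<ge> 0\<close>
          by (intro mult_mono) (auto simp: dist_norm)
        also have "\<dots> = e" using \<open>K \<ge> 0\<close> by simp
        finally have "norm (A y ((\<Sum>i<m. V i y) - U y)) \<le> e" .
        then have "\<bar>h\<bar> * norm (A y ((\<Sum>i<m. V i y) - U y)) \<le> \<bar>h\<bar> * e"
          by (intro mult_left_mono) auto
        moreover have "(\<Sum>i<n. h *\<^sub>R f' i y) - h *\<^sub>R A y (U y) = h *\<^sub>R A y ((\<Sum>i<m. V i y) - U y)"
          unfolding scaleR_sum_right[symmetric] m f'_sum
          by (simp add: blinfun.diff_right scaleR_diff_right)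
        ultimately show ?thesis by (simp add: mult.commute)
      qed
      then show "\<forall>\<^sub>F n in sequentially. \<forall>y\<in>{-R<..<R}. \<forall>h.
          norm ((\<Sum>i<n. h *\<^sub>R f' i y) - h *\<^sub>R A y (U y)) \<le> e * norm h"
        unfolding eventually_sequentially by blast
    qed (use x sums in auto)
    then obtain g where g: "\<And>y. y \<in> {-R<..<R} \<Longrightarrow> (\<lambda>n. V n y) sums g y"
      and "(g has_derivative (\<lambda>h. h *\<^sub>R A x (U x))) (at x within {-R<..<R})"
      using x by blast
    then have g': "(g has_derivative (\<lambda>h. h *\<^sub>R A x (U x))) (at x)"
      using at_within_open[OF x open_greaterThanLessThan] by simp
    have "g y = U y" if "y \<in> {-R<..<R}" for y
      using sums_unique2[OF g[OF that] sums[OF that]] .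
    then have "(U has_vector_derivative A x (U x)) (at x)"
      unfolding has_vector_derivative_def
      by (intro has_derivative_transform_within_open[OF g' _ x]) auto
    then show ?thesis using sums x by simp
  qed
  have "x \<in> {- (\<bar>x\<bar> + 1)<..<\<bar>x\<bar> + 1}" for x :: real by auto
  from local[OF this] have D: "(U has_vector_derivative A x (U x)) (at x)"
    and sums: "(\<lambda>n. V n x) sums U x" for x by auto
  \<comment> \<open>All terms but \<open>V 0\<close> vanish at 0, so the series there reduces to
    \<open>u0\<close>.\<close>
  have "(\<lambda>n. V n 0) sums (\<Sum>n<Suc 0. V n 0)"
  proof (rule sums_finite)
    show "V n 0 = 0" if "n \<notin> {..<Suc 0}" for n
      using that VS0 by (cases n) auto
  qed simp
  with sums[of 0] have "U 0 = u0" by (simp add: V0 sums_unique2)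
  with D show ?thesis by (intro that)
qed

text \<open>The weighted square \<open>exp (- 2 * K * x) * (U x \<bullet> U x)\<close> is
  nonincreasing, because Cauchy-Schwarz bounds the derivative of the squared norm by 2 K times that
  squared norm. Working with the square avoids differentiating the norm at zeros of
  \<open>U\<close>.\<close>

lemma gronwall_norm:
  fixes U :: "real \<Rightarrow> 'a::real_inner"
  assumes "0 \<le> r"
    and U: "\<And>x. 0 \<le> x \<Longrightarrow> x \<le> r \<Longrightarrow> (U has_vector_derivative U' x) (at x)"
    and K: "\<And>x. 0 \<le> x \<Longrightarrow> x \<le> r \<Longrightarrow> norm (U' x) \<le> K * norm (U x)"
  shows "norm (U r) \<le> exp (K * r) * norm (U 0)"
proof -
  define \<phi> where "\<phi> x = exp (- 2 * K * x) * (U x \<bullet> U x)" for x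
  have "\<phi> 0 \<ge> \<phi> r"
  proof (rule DERIV_nonpos_imp_nonincreasing[OF \<open>0 \<le> r\<close>])
    fix x assume x: "0 \<le> x" "x \<le> r"
    have "(\<phi> has_real_derivative exp (- 2 * K * x) * (2 * (U x \<bullet> U' x) - 2 * K * (U x \<bullet> U x))) (at x)"
      unfolding \<phi>_def has_field_derivative_def
      by (rule derivative_eq_intros refl U[OF x, unfolded has_vector_derivative_def])+
        (auto simp: fun_eq_iff algebra_simps inner_commute)
    moreover have "U x \<bullet> U' x \<le> K * (U x \<bullet> U x)"
    proof -
      have "U x \<bullet> U' x \<le> norm (U x) * norm (U' x)" by (rule norm_cauchy_schwarz)
      also have "\<dots> \<le> norm (U x) * (K * norm (U x))"
        using K[OF x] by (intro mult_left_mono) auto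
      finally show ?thesis by (simp add: dot_square_norm power2_eq_square mult_ac)
    qed
    then have "exp (- 2 * K * x) * (2 * (U x \<bullet> U' x) - 2 * K * (U x \<bullet> U x)) \<le> 0"
      by (intro mult_nonneg_nonpos) auto
    ultimately show "\<exists>y. (\<phi> has_real_derivative y) (at x) \<and> y \<le> 0" by blast
  qed
  then have "exp (- 2 * K * r) * (norm (U r))\<^sup>2 \<le> (norm (U 0))\<^sup>2"
    by (simp add: \<phi>_def dot_square_norm)
  then have "exp (2 * K * r) * (exp (- 2 * K * r) * (norm (U r))\<^sup>2) \<le> exp (2 * K * r) * (norm (U 0))\<^sup>2"
    by (intro mult_left_mono) auto
  moreover have "exp (2 * K * r) * (exp (- 2 * K * r) * (norm (U r))\<^sup>2) = (norm (U r))\<^sup>2"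
    by (simp add: mult.assoc[symmetric] exp_add[symmetric])
  moreover have "exp (2 * K * r) = (exp (K * r))\<^sup>2"
    by (simp add: power2_eq_square exp_add[symmetric] mult_ac)
  ultimately have "(norm (U r))\<^sup>2 \<le> (exp (K * r) * norm (U 0))\<^sup>2"
    by (simp only: power_mult_distrib)
  then show ?thesis by (rule power2_le_imp_le) auto
qed

section \<open>The Hill equation as a first-order system\<close>

text \<open>The derivative is carried as a separate function \<open>v\<close>, so that derivative
  rules apply directly, without passing through \<open>vector_derivative\<close>.\<close>

definition hill_pair :: "(real \<Rightarrow> real) \<Rightarrow> complex \<Rightarrow> (real \<Rightarrow> complex) \<Rightarrow> (real \<Rightarrow> complex) \<Rightarrow> bool" where
  "hill_pair Q z u v \<longleftrightarrow>
     (\<forall>x. (u has_vector_derivative v x) (at x) \<and>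
          (v has_vector_derivative (complex_of_real (Q x) - z) * u x) (at x))"

lemma hill_pairD:
  assumes "hill_pair Q z u v"
  shows "(u has_vector_derivative v x) (at x)"
    and "(v has_vector_derivative (complex_of_real (Q x) - z) * u x) (at x)"
  using assms by (auto simp: hill_pair_def)

lemma hill_pair_dx: "hill_pair Q z u v \<Longrightarrow> dx u = v"
  by (auto simp: hill_pair_def dx_def fun_eq_iff intro: vector_derivative_at)

lemma hill_solution_iff_hill_pair: "hill_solution Q z u \<longleftrightarrow> hill_pair Q z u (dx u)"
proof
  assume u: "hill_solution Q z u"
  then have "dx (dx u) x = (complex_of_real (Q x) - z) * u x" for x
    by (simp add: hill_solution_def algebra_simps)
  with u show "hill_pair Q z u (dx u)"
    unfolding hill_solution_def hill_pair_def by (metis dx_def vector_derivative_works)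
next
  assume "hill_pair Q z u (dx u)"
  note D = hill_pairD[OF this]
  have "dx (dx u) x = (complex_of_real (Q x) - z) * u x" for x
    unfolding dx_def[of "dx u"] by (rule vector_derivative_at[OF D(2)])
  with D show "hill_solution Q z u"
    unfolding hill_solution_def
    by (auto intro: differentiableI_vector simp: left_diff_distrib)
qed

section \<open>Linearity and symmetries of the solution space\<close>

lemma hill_pair_continuous:
  assumes "hill_pair Q z u v"
  shows "continuous_on S u" "continuous_on S v"
  using hill_pairD[OF assms]
  by (meson continuous_at_imp_continuous_on has_vector_derivative_continuous)+

lemma hill_pair_lincomb:
  assumes "hill_pair Q z u v" "hill_pair Q z f g"
  shows "hill_pair Q z (\<lambda>x. a * u x + b * f x) (\<lambda>x. a * v x + b * g x)"
  unfolding hill_pair_def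
  by (auto intro!: derivative_eq_intros hill_pairD[OF assms(1)] hill_pairD[OF assms(2)]
      simp: algebra_simps)

lemma hill_pair_cnj:
  assumes "hill_pair Q z u v"
  shows "hill_pair Q (cnj z) (\<lambda>x. cnj (u x)) (\<lambda>x. cnj (v x))"
  using hill_pairD[OF assms] unfolding hill_pair_def
  by (auto intro!: derivative_eq_intros)

lemma hill_pair_reflect:
  assumes "hill_pair Q z u v"
  shows "hill_pair (\<lambda>x. Q (- x)) z (\<lambda>x. u (- x)) (\<lambda>x. - v (- x))"
  using has_vector_derivative_reflect[OF hill_pairD(1)[OF assms]]
    has_vector_derivative_reflect[OF hill_pairD(2)[OF assms]]
  unfolding hill_pair_def by (auto intro!: derivative_eq_intros)

section \<open>Uniqueness and existence for initial value problems\<close>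

lemma hill_pair_norm_bound:
  assumes uv: "hill_pair Q z u v" and "0 \<le> r"
    and K: "\<And>x. 0 \<le> x \<Longrightarrow> x \<le> r \<Longrightarrow> cmod (complex_of_real (Q x) - z) \<le> K"
  shows "norm (u r, v r) \<le> exp ((1 + K) * r) * norm (u 0, v 0)"
proof (rule gronwall_norm[OF \<open>0 \<le> r\<close>])
  fix x assume x: "0 \<le> x" "x \<le> r"
  show "((\<lambda>x. (u x, v x)) has_vector_derivative (v x, (complex_of_real (Q x) - z) * u x)) (at x)"
    by (intro has_vector_derivative_Pair hill_pairD[OF uv])
  have "0 \<le> K" using K[OF x] norm_ge_zero order.trans by blast
  \<comment> \<open>Each component of the right-hand side is at most 1 or \<open>K\<close> times the
    norm of the pair, which gives the Gronwall constant \<open>1 + K\<close>.\<close>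
  have "norm (v x, (complex_of_real (Q x) - z) * u x) \<le> norm (v x) + cmod (complex_of_real (Q x) - z) * norm (u x)"
    using norm_Pair_le by (metis norm_mult)
  also have "\<dots> \<le> norm (u x, v x) + K * norm (u x, v x)"
    using norm_fst_le[of "u x" "v x"] norm_snd_le[of "v x" "u x"] K[OF x] \<open>0 \<le> K\<close>
    by (intro add_mono mult_mono) auto
  finally show "norm (v x, (complex_of_real (Q x) - z) * u x) \<le> (1 + K) * norm (u x, v x)"
    by (simp add: algebra_simps)
qed

text \<open>The growth bound is proportional to the size of the initial data, so zero data force the
  zero solution for x \<ge> 0; reflection handles negative x.\<close>

lemma hill_pair_zero:
  assumes Q: "continuous_on UNIV Q" and uv: "hill_pair Q z u v" "u 0 = 0" "v 0 = 0"
  shows "u x = 0 \<and> v x = 0"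
proof -
  \<comment> \<open>The potential is generalized as well, since reflection replaces \<open>Q\<close>
    by its mirror image.\<close>
  have forward: "u x = 0 \<and> v x = 0"
    if Q: "continuous_on UNIV Q" and uv: "hill_pair Q z u v" "u 0 = 0" "v 0 = 0" and "0 \<le> x"
    for Q u v and x :: real
  proof -
    obtain B where B: "\<And>t. 0 \<le> t \<Longrightarrow> t \<le> x \<Longrightarrow> \<bar>Q t\<bar> \<le> B"
      using continuous_on_interval_bounded[OF continuous_on_subset[OF Q subset_UNIV], of 0 x]
      unfolding real_norm_def by blast
    have "cmod (complex_of_real (Q t) - z) \<le> B + cmod z" if "0 \<le> t" "t \<le> x" for t
      using norm_triangle_ineq4[of "complex_of_real (Q t)" z] B[OF that] by simp
    from hill_pair_norm_bound[OF uv(1) \<open>0 \<le> x\<close> this] uv(2,3)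
    show ?thesis by (simp add: zero_prod_def)
  qed
  show ?thesis
  proof (cases "0 \<le> x")
    case True
    then show ?thesis using forward assms by blast
  next
    case False
    have "continuous_on UNIV (\<lambda>x. Q (- x))"
      by (intro continuous_on_compose2[OF Q] continuous_intros) auto
    from forward[OF this hill_pair_reflect[OF uv(1)], of "- x"] uv False show ?thesis by simp
  qed
qed

lemma hill_pair_unique:
  assumes Q: "continuous_on UNIV Q"
    and "hill_pair Q z u v" "hill_pair Q z f g" "u 0 = f 0" "v 0 = g 0"
  shows "u = f \<and> v = g"
proof -
  have "1 * u x + (- 1) * f x = 0 \<and> 1 * v x + (- 1) * g x = 0" for x
    by (rule hill_pair_zero[OF Q hill_pair_lincomb[OF assms(2,3)]]) (use assms in auto)
  then show ?thesis by (auto simp: fun_eq_iff)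
qed

lemma hill_pair_exists:
  assumes Q: "continuous_on UNIV Q"
  obtains u v where "hill_pair Q z u v" "u 0 = a" "v 0 = b"
proof -
  \<comment> \<open>The coefficient matrix of the first-order system acting on pairs (u,
    u').\<close>
  define L where "L x = (\<lambda>p :: complex \<times> complex. (snd p, (complex_of_real (Q x) - z) * fst p))" for x
  have L: "bounded_linear (L x)" for x
    unfolding L_def
    by (intro bounded_linear_Pair bounded_linear_snd
        bounded_linear_compose[OF bounded_linear_mult_right bounded_linear_fst])
  define A where "A x = Blinfun (L x)" for x
  have A: "blinfun_apply (A x) p = L x p" for x p
    by (simp add: A_def bounded_linear_Blinfun_apply[OF L])
  have "continuous_on UNIV A"
    unfolding A L_def
    by (intro continuous_on_blinfun_componentwise, unfold A L_def)
      (intro continuous_intros continuous_on_compose2[OF Q], auto)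
  from linear_ode_solution_exists[OF this, of "(a, b)"]
  obtain U where U0: "U 0 = (a, b)" and U: "\<And>x. (U has_vector_derivative L x (U x)) (at x)"
    by (auto simp: A)
  have "hill_pair Q z (\<lambda>x. fst (U x)) (\<lambda>x. snd (U x))"
    unfolding hill_pair_def
    using bounded_linear.has_vector_derivative[OF bounded_linear_fst U]
      bounded_linear.has_vector_derivative[OF bounded_linear_snd U]
    by (auto simp: L_def)
  then show ?thesis by (rule that) (simp_all add: U0)
qed

text \<open>Existence and uniqueness make the definite description denote. The hypothesis is an
  equation so that the definitions of \<open>hill_s\<close> and \<open>hill_c\<close> can be plugged
  in directly.\<close>

lemma hill_solution_THE:
  assumes Q: "continuous_on UNIV Q"
    and u: "u = (THE u. hill_solution Q z u \<and> u 0 = a \<and> dx u 0 = b)"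
  shows "hill_pair Q z u (dx u)" "u 0 = a" "dx u 0 = b"
proof -
  obtain f g where fg: "hill_pair Q z f g" "f 0 = a" "g 0 = b"
    using hill_pair_exists[OF Q] by blast
  have "\<exists>!u. hill_solution Q z u \<and> u 0 = a \<and> dx u 0 = b"
  proof (rule ex1I[of _ f])
    show "hill_solution Q z f \<and> f 0 = a \<and> dx f 0 = b"
      using fg hill_pair_dx[OF fg(1)] by (simp add: hill_solution_iff_hill_pair)
    show "u = f" if "hill_solution Q z u \<and> u 0 = a \<and> dx u 0 = b" for u
      using that hill_pair_unique[OF Q _ fg(1), of u "dx u"] fg
      by (simp add: hill_solution_iff_hill_pair)
  qed
  from theI'[OF this] show "hill_pair Q z u (dx u)" "u 0 = a" "dx u 0 = b"
    by (simp_all add: u hill_solution_iff_hill_pair)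
qed

lemmas hill_s = hill_solution_THE[OF _ hill_s_def]
lemmas hill_c = hill_solution_THE[OF _ hill_c_def]

section \<open>Lagrange and Green identities\<close>

text \<open>In the derivative of the Wronskian \<open>u t * g t - v t * f t\<close> the
  first-derivative products and the potential cancel; only the difference of the spectral parameters
  survives.\<close>

lemma lagrange_identity:
  assumes uv: "hill_pair Q w u v" and fg: "hill_pair Q z f g" and "0 \<le> x"
  shows "((\<lambda>t. (w - z) * (u t * f t)) has_integral
          (u x * g x - v x * f x) - (u 0 * g 0 - v 0 * f 0)) {0..x}"
proof (rule fundamental_theorem_of_calculus[OF \<open>0 \<le> x\<close>])
  fix t
  show "((\<lambda>t. u t * g t - v t * f t) has_vector_derivative (w - z) * (u t * f t)) (at t within {0..x})"
    by (rule has_vector_derivative_at_within)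
      (auto intro!: derivative_eq_intros hill_pairD[OF uv] hill_pairD[OF fg] simp: algebra_simps)
qed

lemma wronskian_constant:
  assumes "hill_pair Q z u v" "hill_pair Q z f g" "0 \<le> x"
  shows "u x * g x - v x * f x = u 0 * g 0 - v 0 * f 0"
  using lagrange_identity[OF assms] by simp

lemma wronskian_c_s:
  assumes Q: "continuous_on UNIV Q" and "0 \<le> x"
  shows "hill_c Q z x * dx (hill_s Q z) x - dx (hill_c Q z) x * hill_s Q z x = 1"
  using wronskian_constant[OF hill_c(1)[OF Q] hill_s(1)[OF Q] \<open>0 \<le> x\<close>]
  by (simp add: hill_c[OF Q] hill_s[OF Q])

text \<open>A vanishing integral of the continuous integrand would make \<open>u\<close> zero on the
  whole interval, hence also its derivative at 0, against the nonzero initial data.\<close>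

lemma hill_pair_square_integral_pos:
  assumes uv: "hill_pair Q z u v" and "u 0 \<noteq> 0 \<or> v 0 \<noteq> 0"
  obtains I where "I > 0" "((\<lambda>t. (cmod (u t))\<^sup>2) has_integral I) {0..1}"
proof -
  have cont: "continuous_on (cbox 0 1) (\<lambda>t. (cmod (u t))\<^sup>2)"
    by (intro continuous_intros hill_pair_continuous[OF uv])
  then obtain I where I: "((\<lambda>t. (cmod (u t))\<^sup>2) has_integral I) (cbox 0 1)"
    using integrable_continuous by blast
  have "I \<ge> 0" by (rule has_integral_nonneg[OF I]) simp
  moreover have "I \<noteq> 0"
  proof
    assume "I = 0"
    have u0: "u t = 0" if "t \<in> cbox 0 1" for t
      using has_integral_0_cbox_imp_0[OF cont _ I[unfolded \<open>I = 0\<close>] _ that] by simp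
    \<comment> \<open>Vanishing of \<open>u\<close> is known only to the right of 0, so the
      one-sided derivative within the interval is compared.\<close>
    have "((\<lambda>_. 0) has_vector_derivative v 0) (at 0 within cbox 0 1)"
      by (rule has_vector_derivative_transform[OF _ _ has_vector_derivative_at_within[OF hill_pairD(1)[OF uv]]])
        (use u0 in auto)
    then have "v 0 = 0"
      by (rule vector_derivative_unique_within_closed_interval[rotated 2]) auto
    with u0[of 0] assms show False by simp
  qed
  ultimately show ?thesis using I by (intro that[of I]) auto
qed

text \<open>Lagrange's identity for \<open>u\<close> and its conjugate, which solves the equation at
  \<open>cnj z\<close> because \<open>Q\<close> is real. Both sides are purely imaginary, and their
  imaginary parts carry a common factor 2.\<close>

lemma green_identity:
  assumes uv: "hill_pair Q z u v" and "u 0 \<noteq> 0 \<or> v 0 \<noteq> 0"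
  obtains I where "I > 0" "Im (v 1 * cnj (u 1)) - Im (v 0 * cnj (u 0)) = - Im z * I"
proof -
  obtain I where I: "I > 0" "((\<lambda>t. (cmod (u t))\<^sup>2) has_integral I) {0..1}"
    using hill_pair_square_integral_pos[OF assms] .
  have "((\<lambda>t. (z - cnj z) * complex_of_real ((cmod (u t))\<^sup>2)) has_integral (z - cnj z) * of_real I) {0..1}"
    by (intro has_integral_mult_right has_integral_of_real I(2))
  moreover have "((\<lambda>t. (z - cnj z) * complex_of_real ((cmod (u t))\<^sup>2)) has_integral
      (u 1 * cnj (v 1) - v 1 * cnj (u 1)) - (u 0 * cnj (v 0) - v 0 * cnj (u 0))) {0..1}"
    using lagrange_identity[OF uv hill_pair_cnj[OF uv], of 1]
    by (simp only: complex_norm_square)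
  ultimately have "(z - cnj z) * of_real I =
      (u 1 * cnj (v 1) - v 1 * cnj (u 1)) - (u 0 * cnj (v 0) - v 0 * cnj (u 0))"
    by (rule has_integral_unique)
  from arg_cong[OF this, of Im] show ?thesis
    by (intro that[OF I(1)]) (simp add: algebra_simps)
qed

section \<open>Analytic dependence on the spectral parameter\<close>

text \<open>Lagrange's identity tested against s and c at parameter \<open>z\<close> yields two
  linear equations for the differences \<open>u x - f x\<close> and \<open>v x - g x\<close>. Their
  determinant is the Wronskian of c and s, which is 1, so Cramer's rule solves them.\<close>

lemma duhamel_formula:
  fixes Q :: "real \<Rightarrow> real"
  assumes Q: "continuous_on UNIV Q"
    and uv: "hill_pair Q w u v" and fg: "hill_pair Q z f g"
    and init: "u 0 = f 0" "v 0 = g 0" and "0 \<le> x"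
  defines "J \<equiv> \<lambda>k. integral {0..x} (\<lambda>t. u t * k t)"
  shows "u x - f x = (w - z) * (hill_c Q z x * J (hill_s Q z) - hill_s Q z x * J (hill_c Q z))"
    and "v x - g x = (w - z) *
           (dx (hill_c Q z) x * J (hill_s Q z) - dx (hill_s Q z) x * J (hill_c Q z))"
proof -
  have J: "(w - z) * J k = (u x - f x) * l x - (v x - g x) * k x" if kl: "hill_pair Q z k l" for k l
  proof -
    have "(w - z) * J k = integral {0..x} (\<lambda>t. (w - z) * (u t * k t))"
      unfolding J_def by simp
    also have "\<dots> = (u x * l x - v x * k x) - (u 0 * l 0 - v 0 * k 0)"
      by (rule integral_unique[OF lagrange_identity[OF uv kl \<open>0 \<le> x\<close>]])
    \<comment> \<open>The common initial data turn the boundary term at 0 into a Wronskian of two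
      solutions at \<open>z\<close>, which may be moved to \<open>x\<close>.\<close>
    also have "u 0 * l 0 - v 0 * k 0 = f x * l x - g x * k x"
      using wronskian_constant[OF fg kl \<open>0 \<le> x\<close>] init by simp
    finally show ?thesis by (simp add: algebra_simps)
  qed
  note Js = J[OF hill_s(1)[OF Q]] and Jc = J[OF hill_c(1)[OF Q]]
  have rearrange: "(w - z) * (a * J k - b * J l) = a * ((w - z) * J k) - b * ((w - z) * J l)" for a b k l
    by (simp add: algebra_simps)
  note W = wronskian_c_s[OF Q \<open>0 \<le> x\<close>, of z]
  \<comment> \<open>Weighting the two equations by c and s eliminates \<open>v x - g x\<close>; the
    weights c' and s' below eliminate \<open>u x - f x\<close>.\<close>
  have "(w - z) * (hill_c Q z x * J (hill_s Q z) - hill_s Q z x * J (hill_c Q z)) =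
      (u x - f x) * (hill_c Q z x * dx (hill_s Q z) x - dx (hill_c Q z) x * hill_s Q z x)"
    unfolding rearrange Js Jc by (simp add: algebra_simps)
  with W show "u x - f x = (w - z) * (hill_c Q z x * J (hill_s Q z) - hill_s Q z x * J (hill_c Q z))"
    by simp
  have "(w - z) * (dx (hill_c Q z) x * J (hill_s Q z) - dx (hill_s Q z) x * J (hill_c Q z)) =
      (v x - g x) * (hill_c Q z x * dx (hill_s Q z) x - dx (hill_c Q z) x * hill_s Q z x)"
    unfolding rearrange Js Jc by (simp add: algebra_simps)
  with W show "v x - g x = (w - z) *
      (dx (hill_c Q z) x * J (hill_s Q z) - dx (hill_s Q z) x * J (hill_c Q z))"
    by simp
qed

section \<open>Bounds uniform in the spectral parameter\<close>

lemma norm_integral_product_le: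
  fixes u k :: "real \<Rightarrow> complex"
  assumes "0 \<le> x" "x \<le> 1" "continuous_on {0..x} u" "continuous_on {0..x} k"
    and u: "\<And>t. 0 \<le> t \<Longrightarrow> t \<le> 1 \<Longrightarrow> cmod (u t) \<le> M"
    and k: "\<And>t. 0 \<le> t \<Longrightarrow> t \<le> 1 \<Longrightarrow> cmod (k t) \<le> F"
  shows "cmod (integral {0..x} (\<lambda>t. u t * k t)) \<le> M * F"
proof -
  have "0 \<le> M" "0 \<le> F"
    using order.trans[OF norm_ge_zero u[of 0]] order.trans[OF norm_ge_zero k[of 0]] by auto
  have "cmod (integral {0..x} (\<lambda>t. u t * k t)) \<le> M * F * (x - 0)"
  proof (rule integral_bound)
    fix t assume "t \<in> {0..x}"
    then show "cmod (u t * k t) \<le> M * F"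
      unfolding norm_mult using u k \<open>x \<le> 1\<close> \<open>0 \<le> M\<close> by (intro mult_mono) auto
  qed (intro assms continuous_on_mult)+
  also have "\<dots> \<le> M * F"
    using \<open>0 \<le> M\<close> \<open>0 \<le> F\<close> \<open>x \<le> 1\<close> by (intro mult_left_le) auto
  finally show ?thesis .
qed

text \<open>\<open>M\<close> is chosen before \<open>w\<close>: the Gronwall constant depends on the
  parameter only through the radius \<open>r\<close>. This uniformity makes the Duhamel integrals
  continuous in \<open>w\<close>.\<close>

lemma hill_pair_unit_interval_bound:
  assumes Q: "continuous_on UNIV Q"
  obtains M where "\<And>w u v t. hill_pair Q w u v \<Longrightarrow> u 0 = a \<Longrightarrow> v 0 = b \<Longrightarrow>
    cmod w \<le> r \<Longrightarrow> 0 \<le> t \<Longrightarrow> t \<le> 1 \<Longrightarrow> cmod (u t) \<le> M"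
proof -
  obtain B where "0 \<le> B" and B: "\<And>x. 0 \<le> x \<Longrightarrow> x \<le> 1 \<Longrightarrow> \<bar>Q x\<bar> \<le> B"
    using continuous_on_interval_bounded[OF continuous_on_subset[OF Q subset_UNIV], of 0 1]
    unfolding real_norm_def by blast
  show ?thesis
  proof
    fix w u v and t :: real
    assume uv: "hill_pair Q w u v" "u 0 = a" "v 0 = b" and w: "cmod w \<le> r" and t: "0 \<le> t" "t \<le> 1"
    have "cmod (complex_of_real (Q x) - w) \<le> B + r" if "0 \<le> x" "x \<le> t" for x
      using norm_triangle_ineq4[of "complex_of_real (Q x)" w] B[of x] that t w by simp
    from hill_pair_norm_bound[OF uv(1) t(1) this]
    have "norm (u t, v t) \<le> exp ((1 + (B + r)) * t) * norm (a, b)"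
      by (simp add: uv)
    also have "(1 + (B + r)) * t \<le> 1 + (B + r)"
      using \<open>0 \<le> B\<close> w t order.trans[OF norm_ge_zero w] by (intro mult_left_le) auto
    finally have "norm (u t, v t) \<le> exp (1 + (B + r)) * norm (a, b)"
      by (simp add: mult_right_mono)
    then show "cmod (u t) \<le> exp (1 + (B + r)) * norm (a, b)"
      using norm_fst_le[of "u t" "v t"] by linarith
  qed
qed

text \<open>By \<open>duhamel_formula\<close> the difference quotient at \<open>z\<close> is a
  combination of the integrals \<open>J k w\<close> with coefficients depending only on
  \<open>z\<close>, so it suffices that these integrals are continuous in \<open>w\<close> at
  \<open>z\<close>.\<close>

lemma hill_pair_holomorphic:
  assumes Q: "continuous_on UNIV Q"
    and y: "\<And>w. hill_pair Q w (y w) (y' w)" "\<And>w. y w 0 = a" "\<And>w. y' w 0 = b"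
  shows "(\<lambda>w. y w 1) holomorphic_on UNIV" and "(\<lambda>w. y' w 1) holomorphic_on UNIV"
proof -
  have init: "y w 0 = y z 0" "y' w 0 = y' z 0" for w z
    by (simp_all add: y)
  define J where "J k w = integral {0..1} (\<lambda>t. y w t * k t)" for k w
  note cont = hill_pair_continuous(1)[OF y(1)] hill_pair_continuous(1)[OF hill_s(1)[OF Q]]
    hill_pair_continuous(1)[OF hill_c(1)[OF Q]]
  have J_tendsto: "(J (hill_s Q z) \<longlongrightarrow> J (hill_s Q z) z) (at z)"
      "(J (hill_c Q z) \<longlongrightarrow> J (hill_c Q z) z) (at z)" for z
  proof -
    obtain M where M: "\<And>w t. cmod w \<le> cmod z + 1 \<Longrightarrow> 0 \<le> t \<Longrightarrow> t \<le> 1 \<Longrightarrow> cmod (y w t) \<le> M"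
    proof (rule hill_pair_unit_interval_bound[OF Q, of a b "cmod z + 1"])
      fix M assume "\<And>w u v t. hill_pair Q w u v \<Longrightarrow> u 0 = a \<Longrightarrow> v 0 = b \<Longrightarrow>
        cmod w \<le> cmod z + 1 \<Longrightarrow> 0 \<le> t \<Longrightarrow> t \<le> 1 \<Longrightarrow> cmod (u t) \<le> M"
      from that[OF this[OF y]] show ?thesis .
    qed
    obtain S where "0 \<le> S" and S: "\<And>t. 0 \<le> t \<Longrightarrow> t \<le> 1 \<Longrightarrow> cmod (hill_s Q z t) \<le> S"
      using continuous_on_interval_bounded[of 0 1 "hill_s Q z", OF cont(2)] by blast
    obtain C where "0 \<le> C" and C: "\<And>t. 0 \<le> t \<Longrightarrow> t \<le> 1 \<Longrightarrow> cmod (hill_c Q z t) \<le> C"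
      using continuous_on_interval_bounded[of 0 1 "hill_c Q z", OF cont(3)] by blast
    \<comment> \<open>Bounds the bracket in the Duhamel formula: |c| \<le> \<open>C\<close> against
      an integral of size \<open>M * S\<close>, plus |s| \<le> \<open>S\<close> against one of size
      \<open>M * C\<close>.\<close>
    define D where "D = C * (M * S) + S * (M * C)"
    have lipschitz: "cmod (y w t - y z t) \<le> cmod (w - z) * D"
      if w: "cmod w \<le> cmod z + 1" and t: "0 \<le> t" "t \<le> 1" for w t
    proof -
      let ?J = "\<lambda>k. integral {0..t} (\<lambda>x. y w x * k x)"
      have "cmod (hill_c Q z t * ?J (hill_s Q z) - hill_s Q z t * ?J (hill_c Q z))
          \<le> cmod (hill_c Q z t) * cmod (?J (hill_s Q z)) + cmod (hill_s Q z t) * cmod (?J (hill_c Q z))"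
        unfolding norm_mult[symmetric] by (rule norm_triangle_ineq4)
      also have "\<dots> \<le> D"
        unfolding D_def using M[OF w] S C t \<open>0 \<le> S\<close> \<open>0 \<le> C\<close>
        by (intro add_mono mult_mono norm_integral_product_le cont) auto
      finally show ?thesis
        unfolding duhamel_formula(1)[OF Q y(1) y(1)[of z] init t(1)] norm_mult
        by (intro mult_left_mono) auto
    qed
    have tendsto: "(J k \<longlongrightarrow> J k z) (at z)"
      if k: "continuous_on {0..1} k" "\<And>t. 0 \<le> t \<Longrightarrow> t \<le> 1 \<Longrightarrow> cmod (k t) \<le> F" for k F
    proof (rule LIM_zero_cancel, rule Lim_null_comparison)
      have "norm (J k w - J k z) \<le> cmod (w - z) * D * F" if "dist w z < 1" for w
      proof -
        have "cmod w \<le> cmod z + 1"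
          using that norm_triangle_sub[of w z] by (simp add: dist_norm)
        note L = lipschitz[OF this]
        have "J k w - J k z = integral {0..1} (\<lambda>t. (y w t - y z t) * k t)"
          unfolding J_def left_diff_distrib
          by (intro integral_diff[symmetric] integrable_continuous_real continuous_intros cont k)
        also have "cmod \<dots> \<le> cmod (w - z) * D * F"
          using L k by (intro norm_integral_product_le continuous_intros cont) auto
        finally show ?thesis .
      qed
      then show "\<forall>\<^sub>F w in at z. norm (J k w - J k z) \<le> cmod (w - z) * D * F"
        unfolding eventually_at by (intro exI[of _ 1]) auto
      show "((\<lambda>w. cmod (w - z) * D * F) \<longlongrightarrow> 0) (at z)"
        by (auto intro!: tendsto_eq_intros)
    qed
    show "(J (hill_s Q z) \<longlongrightarrow> J (hill_s Q z) z) (at z)"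
      "(J (hill_c Q z) \<longlongrightarrow> J (hill_c Q z) z) (at z)"
      using tendsto[OF cont(2) S] tendsto[OF cont(3) C] by blast+
  qed
  have deriv: "h field_differentiable (at z)"
    if h: "\<And>w. h w - h z = (w - z) * (\<alpha> * J (hill_s Q z) w - \<beta> * J (hill_c Q z) w)" for h \<alpha> \<beta> z
  proof -
    have "((\<lambda>w. \<alpha> * J (hill_s Q z) w - \<beta> * J (hill_c Q z) w) \<longlongrightarrow>
        \<alpha> * J (hill_s Q z) z - \<beta> * J (hill_c Q z) z) (at z)"
      by (intro tendsto_intros J_tendsto)
    then have "((\<lambda>w. (h w - h z) / (w - z)) \<longlongrightarrow>
        \<alpha> * J (hill_s Q z) z - \<beta> * J (hill_c Q z) z) (at z)"
      by (rule Lim_transform_eventually) (auto simp: h eventually_at_filter)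
    then show ?thesis
      unfolding field_differentiable_def has_field_derivative_iff by blast
  qed
  have "(\<lambda>w. y w 1) field_differentiable (at z)" for z
    by (rule deriv[where h = "\<lambda>w. y w 1" and \<alpha> = "hill_c Q z 1" and \<beta> = "hill_s Q z 1"], unfold J_def)
      (rule duhamel_formula(1)[OF Q y(1) y(1) init zero_le_one])
  then show "(\<lambda>w. y w 1) holomorphic_on UNIV"
    unfolding holomorphic_on_def by blast
  have "(\<lambda>w. y' w 1) field_differentiable (at z)" for z
    by (rule deriv[where h = "\<lambda>w. y' w 1" and \<alpha> = "dx (hill_c Q z) 1" and \<beta> = "dx (hill_s Q z) 1"],
        unfold J_def)
      (rule duhamel_formula(2)[OF Q y(1) y(1) init zero_le_one])
  then show "(\<lambda>w. y' w 1) holomorphic_on UNIV"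
    unfolding holomorphic_on_def by blast
qed

section \<open>The Herglotz property\<close>

text \<open>Conjugating a solution at \<open>z\<close> gives one at \<open>cnj z\<close>; the
  initial data 0 and 1 are real, so uniqueness identifies the two.\<close>

lemma hill_s_discriminant_cnj:
  assumes Q: "continuous_on UNIV Q"
  shows "hill_s Q (cnj z) 1 = cnj (hill_s Q z 1)" "discriminant Q (cnj z) = cnj (discriminant Q z)"
proof -
  have s: "hill_s Q (cnj z) = (\<lambda>x. cnj (hill_s Q z x)) \<and>
      dx (hill_s Q (cnj z)) = (\<lambda>x. cnj (dx (hill_s Q z) x))"
    by (rule hill_pair_unique[OF Q hill_s(1)[OF Q] hill_pair_cnj[OF hill_s(1)[OF Q]]])
      (simp_all add: hill_s[OF Q])
  have c: "hill_c Q (cnj z) = (\<lambda>x. cnj (hill_c Q z x)) \<and>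
      dx (hill_c Q (cnj z)) = (\<lambda>x. cnj (dx (hill_c Q z) x))"
    by (rule hill_pair_unique[OF Q hill_c(1)[OF Q] hill_pair_cnj[OF hill_c(1)[OF Q]]])
      (simp_all add: hill_c[OF Q])
  show "hill_s Q (cnj z) 1 = cnj (hill_s Q z 1)"
    by (simp add: s)
  show "discriminant Q (cnj z) = cnj (discriminant Q z)"
    unfolding discriminant_def s[THEN conjunct2] c[THEN conjunct1] by simp
qed

text \<open>A zero at 1 would make both boundary terms of Green's identity vanish, leaving
  \<open>Im z * I = 0\<close> with \<open>I > 0\<close>.\<close>

lemma hill_s_nonzero:
  assumes Q: "continuous_on UNIV Q" and "Im z \<noteq> 0"
  shows "hill_s Q z 1 \<noteq> 0"
proof
  assume s: "hill_s Q z 1 = 0"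
  obtain I where "I > 0" "Im (dx (hill_s Q z) 1 * cnj (hill_s Q z 1))
      - Im (dx (hill_s Q z) 0 * cnj (hill_s Q z 0)) = - Im z * I"
    using green_identity[OF hill_s(1)[OF Q], of z] hill_s(3)[OF Q, of z] by auto
  with s \<open>Im z \<noteq> 0\<close> show False by (simp add: hill_s[OF Q])
qed

(* The Green identity is applied to the solution with u(0) = 1 and u(1) = b, for which
   u'(1) cnj(u(1)) - u'(0) cnj(u(0)) = (Delta(z) - 2 b) / s(1;z). *)
lemma discriminant_quotient_Im:
  fixes b :: complex
  assumes Q: "continuous_on UNIV Q" and z: "Im z \<noteq> 0" and b: "b = 1 \<or> b = - 1"
  obtains I where "I > 0" "Im (- ((discriminant Q z - 2 * b) / hill_s Q z 1)) = Im z * I"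
proof -
  let ?s = "hill_s Q z" and ?c = "hill_c Q z"
  \<comment> \<open>The slope at 0 that makes the solution starting from 1 reach the value
    \<open>b\<close> at 1.\<close>
  define m where "m = (b - ?c 1) / ?s 1"
  define u where "u x = 1 * ?c x + m * ?s x" for x
  define v where "v x = 1 * dx ?c x + m * dx ?s x" for x
  have s1: "?s 1 \<noteq> 0" by (rule hill_s_nonzero[OF Q z])
  have "hill_pair Q z u v"
    unfolding u_def v_def by (rule hill_pair_lincomb[OF hill_c(1)[OF Q] hill_s(1)[OF Q]])
  moreover have init: "u 0 = 1" "v 0 = m"
    by (simp_all add: u_def v_def hill_s[OF Q] hill_c[OF Q])
  ultimately obtain I where I: "I > 0" "Im (v 1 * cnj (u 1)) - Im (v 0 * cnj (u 0)) = - Im z * I"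
    using green_identity[of Q z u v] by auto
  have "b * b = 1" using b by auto
  have "u 1 = b" using s1 by (simp add: u_def m_def)
  \<comment> \<open>As \<open>b\<close> is 1 or -1, it equals its own conjugate.\<close>
  with I(2) init b have "Im (v 1 * b - m) = - Im z * I" by auto
  moreover have "v 1 * b - m = (discriminant Q z - 2 * b) / ?s 1"
  proof -
    \<comment> \<open>After clearing the denominator, \<open>b * b = 1\<close> produces the
      discriminant, and the Wronskian supplies the second of the two copies of
      \<open>b\<close>.\<close>
    have "(v 1 * b - m) * ?s 1 = b * dx ?c 1 * ?s 1 + (m * ?s 1) * (b * dx ?s 1 - 1)"
      by (simp add: v_def algebra_simps)
    also have "m * ?s 1 = b - ?c 1" using s1 by (simp add: m_def)
    also have "b * dx ?c 1 * ?s 1 + (b - ?c 1) * (b * dx ?s 1 - 1) =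
        (b * b) * dx ?s 1 + ?c 1 - b - b * (?c 1 * dx ?s 1 - dx ?c 1 * ?s 1)"
      by (simp add: algebra_simps)
    also have "\<dots> = discriminant Q z - 2 * b"
      using wronskian_c_s[OF Q, of 1 z] \<open>b * b = 1\<close> by (simp add: discriminant_def)
    finally show ?thesis using s1 by (simp add: field_simps)
  qed
  ultimately have "Im ((discriminant Q z - 2 * b) / ?s 1) = - Im z * I"
    by simp
  then show ?thesis by (intro that[OF I(1)]) simp
qed

text \<open>Treats both functions at once: \<open>b = 1\<close> gives \<open>h_minus\<close> and
  \<open>b = - 1\<close> gives \<open>h_plus\<close>.\<close>

lemma herglotz_discriminant_quotient:
  fixes b :: complex
  assumes Q: "continuous_on UNIV Q" and b: "b = 1 \<or> b = - 1"
  defines "h \<equiv> \<lambda>z. - ((discriminant Q z - 2 * b) / hill_s Q z 1)"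
  shows "herglotz h" and "\<not> h constant_on (UNIV - \<real>)"
proof -
  have Im_nonzero: "z \<in> UNIV - \<real> \<longleftrightarrow> Im z \<noteq> 0" for z
    by (simp add: complex_is_Real_iff)
  have cnj: "h (cnj z) = cnj (h z)" for z
    using b by (auto simp: h_def hill_s_discriminant_cnj[OF Q])
  have "h holomorphic_on (UNIV - \<real>)"
    unfolding h_def discriminant_def
  proof (intro holomorphic_intros)
    show "(\<lambda>z. hill_s Q z 1) holomorphic_on UNIV - \<real>"
      by (rule holomorphic_on_subset[OF hill_pair_holomorphic(1)[OF Q hill_s[OF Q]]]) simp
    show "(\<lambda>z. dx (hill_s Q z) 1) holomorphic_on UNIV - \<real>"
      by (rule holomorphic_on_subset[OF hill_pair_holomorphic(2)[OF Q hill_s[OF Q]]]) simp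
    show "(\<lambda>z. hill_c Q z 1) holomorphic_on UNIV - \<real>"
      by (rule holomorphic_on_subset[OF hill_pair_holomorphic(1)[OF Q hill_c[OF Q]]]) simp
    show "hill_s Q z 1 \<noteq> 0" if "z \<in> UNIV - \<real>" for z
      using that hill_s_nonzero[OF Q] Im_nonzero by blast
  qed
  moreover have "Im z * Im (h z) \<ge> 0" if z: "Im z \<noteq> 0" for z
  proof -
    obtain I where "I > 0" "Im (h z) = Im z * I"
      using discriminant_quotient_Im[OF Q z b] unfolding h_def .
    then show ?thesis by (simp add: mult.assoc[symmetric])
  qed
  ultimately show "herglotz h"
    unfolding herglotz_def using cnj Im_nonzero by blast
  show "\<not> h constant_on (UNIV - \<real>)"
  proof
    assume "h constant_on (UNIV - \<real>)"
    then obtain c where "\<And>z. Im z \<noteq> 0 \<Longrightarrow> h z = c"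
      unfolding constant_on_def using Im_nonzero by blast
    \<comment> \<open>Equal values at i and -i, combined with conjugation symmetry, make h(i) real,
      whereas its imaginary part is the positive number \<open>I\<close>.\<close>
    then have "h (cnj \<i>) = h \<i>" by simp
    moreover obtain I where "I > 0" "Im (h \<i>) = Im \<i> * I"
      using discriminant_quotient_Im[OF Q _ b, of \<i>] unfolding h_def by auto
    ultimately show False
      unfolding cnj by (simp add: complex_eq_iff)
  qed
qed

theorem mainTheorem1:
  fixes Q :: "real \<Rightarrow> real" and h_plus h_minus :: "complex \<Rightarrow> complex"
  defines "h_plus \<equiv> \<lambda>z. - ((discriminant Q z + 2) / hill_s Q z 1)"
    and "h_minus \<equiv> \<lambda>z. - ((discriminant Q z - 2) / hill_s Q z 1)"
  assumes "continuous_on UNIV Q"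
    and "\<And>x. Q (x + 1) = Q x"
  shows "herglotz h_plus \<and> \<not> h_plus constant_on (UNIV - \<real>) \<and>
         herglotz h_minus \<and> \<not> h_minus constant_on (UNIV - \<real>)"
  using herglotz_discriminant_quotient[OF \<open>continuous_on UNIV Q\<close>, of 1]
    herglotz_discriminant_quotient[OF \<open>continuous_on UNIV Q\<close>, of "- 1"]
  unfolding h_plus_def h_minus_def by simp

end
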